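(* Let $$f(\zeta,u)=e^{ik}\log\zeta+g\,\zeta,$$ where $k$ is a real constant and $g=g(u)$ is a complex-valued function (class $\mathrm{AL}_{13}$). For the corresponding vacuum pp-wave the following are equivalent: (i) $d\alpha\wedge d\nu=0$; (ii) $Y=0$; (iii) $g=0$.
   Context: Setting. Everything is local, on a small connected coordinate domain (with $\zeta\neq0$) with coordinates $(\zeta,\zeta^*,u,v)$, $\zeta$ complex, $u,v$ real; $^*$ (or a bar) is complex conjugation. A (non-flat) vacuum pp-wave is a metric $ds^2=2\,d\zeta\,d\bar\zeta-2\,du\,dv-2(f+\bar f)\,du^2$ with $f=f(\zeta,u)$ complex analytic in $\zeta$, smooth in $u$, $f_{\zeta\zeta}\neq0$ everywhere. Equalities are meant identically on the domain. Normalized tetrad and scalars. Let $a=\tfrac14\log f_{\zeta\zeta}$ and $\alpha=e^{a-a^*}(a_\zeta)^*$ (which is nowhere zero here). Write $\zeta=Z(a,u)$, $L=\log Z_a$ (functions of $(a,u)$), and let $\omega^1=(\alpha^* )^{-1}da=e^{a-a^*}(d\zeta-Z_u\,du)$, $\omega^2=(\omega^1)^*$, $\omega^3=e^{a+a^*}du$, $\omega^4=e^{-a-a^*}\big((f+f^*+Z_uZ_u^* )du+dv-Z_u\,d\zeta^*-Z_u^*\,d\zeta\big)$, so the metric is $2\omega^1\omega^2-2\omega^3\omega^4$. Its dual frame $(\delta,\delta^*,\Delta,D)$ is the null tetrad normalized by $\Psi_4=1$, $\gamma=0$ (Newman–Penrose notation). On functions of $(a,a^*,u)$: $\delta Q=\alpha^*Q_a$,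 $\delta^*Q=\alpha Q_{a^*}$, $\Delta Q=e^{-a-a^*}Q_u$ ($a,a^*$ fixed), $DQ=0$. The remaining spin coefficients are $\mu=e^{-a-a^*}L_u$ (zero here) and $\nu=e^{-a-3a^*}(Z_{uu}+(f_\zeta)^* )$. Invariants: $A=\delta^*\alpha/\alpha^2$ and $Y=(3-A)\nu-1/\alpha+(\Delta\mu+\mu^2)/\alpha^*$. *)

theory Defs
  imports "HOL-Analysis.Analysis"
begin

text \<open>
  A point of a chart has coordinates \<open>(\<zeta>, u, v)\<close> with \<open>\<zeta>\<close> complex and \<open>u, v\<close> real; tangent vectors
  have components of the same type, and complex one-forms are real-linear maps into the complex
  numbers. A complex function of \<open>\<zeta>\<close> and its conjugate is just a function of \<open>\<zeta>\<close>.
\<close>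

type_synonym pt = "complex \<times> real \<times> real"
type_synonym cfun = "complex \<Rightarrow> real \<Rightarrow> complex"
type_synonym form = "pt \<Rightarrow> complex"

definition d\<zeta> :: form where "d\<zeta> \<xi> = fst \<xi>"
definition du :: form where "du \<xi> = of_real (fst (snd \<xi>))"
definition dv :: form where "dv \<xi> = of_real (snd (snd \<xi>))"

definition ext_d :: "(pt \<Rightarrow> complex) \<Rightarrow> pt \<Rightarrow> form" where
  "ext_d Q p = frechet_derivative Q (at p)"

definition wedge :: "form \<Rightarrow> form \<Rightarrow> pt \<Rightarrow> pt \<Rightarrow> complex" where
  "wedge \<phi> \<psi> = (\<lambda>\<xi> \<eta>. \<phi> \<xi> * \<psi> \<eta> - \<phi> \<eta> * \<psi> \<xi>)"

primrec higher_differentiable ::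
  "nat \<Rightarrow> ('a::real_normed_vector \<Rightarrow> 'b::real_normed_vector) \<Rightarrow> 'a set \<Rightarrow> bool" where
  "higher_differentiable 0 h S \<longleftrightarrow> continuous_on S h"
| "higher_differentiable (Suc n) h S \<longleftrightarrow>
     (\<forall>x\<in>S. h differentiable at x) \<and>
     (\<forall>w. higher_differentiable n (\<lambda>x. frechet_derivative h (at x) w) S)"

text \<open>Real \<open>C\<^sup>\<infinity>\<close> regularity; meant for open sets.\<close>
definition smooth :: "('a::real_normed_vector \<Rightarrow> 'b::real_normed_vector) \<Rightarrow> 'a set \<Rightarrow> bool" where
  "smooth h S \<longleftrightarrow> (\<forall>n. higher_differentiable n h S)"

definition \<zeta>u_domain :: "pt set \<Rightarrow> (complex \<times> real) set" where
  "\<zeta>u_domain M = (\<lambda>(\<zeta>, u, v). (\<zeta>, u)) ` M"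

text \<open>
  Partial derivatives of functions of a complex variable (holomorphically) and a real one.
\<close>
definition dcx :: "cfun \<Rightarrow> complex \<Rightarrow> real \<Rightarrow> complex" where
  "dcx h z u = deriv (\<lambda>w. h w u) z"

definition dre :: "cfun \<Rightarrow> complex \<Rightarrow> real \<Rightarrow> complex" where
  "dre h z u = vector_derivative (\<lambda>t. h z t) (at u)"

definition vacuum_pp_wave :: "pt set \<Rightarrow> cfun \<Rightarrow> bool" where
  "vacuum_pp_wave M f \<longleftrightarrow>
     open M \<and> connected M \<and> M \<noteq> {} \<and> (\<forall>(\<zeta>, u, v)\<in>M. \<zeta> \<noteq> 0) \<and>
     smooth (\<lambda>(\<zeta>, u). f \<zeta> u) (\<zeta>u_domain M) \<and>
     (\<forall>(\<zeta>, u, v)\<in>M. (\<lambda>w. f w u) analytic_on {\<zeta>}) \<and>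
     (\<forall>(\<zeta>, u, v)\<in>M. dcx (dcx f) \<zeta> u \<noteq> 0)"

text \<open>The metric \<open>2 d\<zeta> d\<zeta>\<^sup>* - 2 du dv - 2 (f + f\<^sup>*) du\<^sup>2\<close> as a symmetric bilinear form.\<close>
definition pp_metric :: "cfun \<Rightarrow> pt \<Rightarrow> pt \<Rightarrow> pt \<Rightarrow> complex" where
  "pp_metric f = (\<lambda>(\<zeta>, u, v) \<xi> \<eta>.
     d\<zeta> \<xi> * cnj (d\<zeta> \<eta>) + d\<zeta> \<eta> * cnj (d\<zeta> \<xi>) - (du \<xi> * dv \<eta> + du \<eta> * dv \<xi>)
     - 2 * (f \<zeta> u + cnj (f \<zeta> u)) * du \<xi> * du \<eta>)"

text \<open>
  A choice of the local data attached to \<open>f\<close>: a continuous branch \<open>a\<close> of \<open>1/4 log f\<^sub>\<zeta>\<^sub>\<zeta>\<close>, the inverse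
  \<open>\<zeta> = Z(a, u)\<close> of \<open>\<zeta> \<mapsto> a(\<zeta>, u)\<close>, and a continuous branch \<open>L\<close> of \<open>log Z\<^sub>a\<close> as a function of
  \<open>(a, u)\<close>. Existence of these is the smallness of the chart \<open>M\<close>.
\<close>
definition pp_wave_data :: "pt set \<Rightarrow> cfun \<Rightarrow> cfun \<Rightarrow> cfun \<Rightarrow> cfun \<Rightarrow> bool" where
  "pp_wave_data M f a Z L \<longleftrightarrow>
     continuous_on (\<zeta>u_domain M) (\<lambda>(\<zeta>, u). a \<zeta> u) \<and>
     (\<forall>(\<zeta>, u)\<in>\<zeta>u_domain M. exp (4 * a \<zeta> u) = dcx (dcx f) \<zeta> u) \<and>
     (\<forall>(\<zeta>, u)\<in>\<zeta>u_domain M. Z (a \<zeta> u) u = \<zeta>) \<and>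
     continuous_on ((\<lambda>(\<zeta>, u). (a \<zeta> u, u)) ` \<zeta>u_domain M) (\<lambda>(b, u). L b u) \<and>
     (\<forall>(\<zeta>, u)\<in>\<zeta>u_domain M. exp (L (a \<zeta> u) u) = dcx Z (a \<zeta> u) u)"

definition coframe1 :: "cfun \<Rightarrow> cfun \<Rightarrow> pt \<Rightarrow> form" where
  "coframe1 a Z = (\<lambda>(\<zeta>, u, v) \<xi>.
     exp (a \<zeta> u - cnj (a \<zeta> u)) * (d\<zeta> \<xi> - dre Z (a \<zeta> u) u * du \<xi>))"

definition coframe2 :: "cfun \<Rightarrow> cfun \<Rightarrow> pt \<Rightarrow> form" where
  "coframe2 a Z p \<xi> = cnj (coframe1 a Z p \<xi>)"

definition coframe3 :: "cfun \<Rightarrow> pt \<Rightarrow> form" where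
  "coframe3 a = (\<lambda>(\<zeta>, u, v) \<xi>. exp (a \<zeta> u + cnj (a \<zeta> u)) * du \<xi>)"

definition coframe4 :: "cfun \<Rightarrow> cfun \<Rightarrow> cfun \<Rightarrow> pt \<Rightarrow> form" where
  "coframe4 f a Z = (\<lambda>(\<zeta>, u, v) \<xi>.
     let Zu = dre Z (a \<zeta> u) u in
     exp (- a \<zeta> u - cnj (a \<zeta> u)) *
       ((f \<zeta> u + cnj (f \<zeta> u) + Zu * cnj Zu) * du \<xi> + dv \<xi> - Zu * cnj (d\<zeta> \<xi>) - cnj Zu * d\<zeta> \<xi>))"

text \<open>
  The dual frame \<open>(\<delta>, \<delta>\<^sup>*, \<Delta>, D)\<close> acts on functions as the coefficients of \<open>dQ\<close> in the coframe:
  \<open>dQ = \<delta>Q \<omega>\<^sup>1 + \<delta>\<^sup>*Q \<omega>\<^sup>2 + \<Delta>Q \<omega>\<^sup>3 + DQ \<omega>\<^sup>4\<close>. Well-definedness is lemma \<open>coframe_expansion\<close> below.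
\<close>
definition in_coframe :: "cfun \<Rightarrow> cfun \<Rightarrow> cfun \<Rightarrow> pt \<Rightarrow> form \<Rightarrow>
    complex \<times> complex \<times> complex \<times> complex \<Rightarrow> bool" where
  "in_coframe f a Z p \<phi> = (\<lambda>(q1, q2, q3, q4). \<forall>\<xi>.
     \<phi> \<xi> = q1 * coframe1 a Z p \<xi> + q2 * coframe2 a Z p \<xi> + q3 * coframe3 a p \<xi>
            + q4 * coframe4 f a Z p \<xi>)"

definition frame_derivs :: "cfun \<Rightarrow> cfun \<Rightarrow> cfun \<Rightarrow> (pt \<Rightarrow> complex) \<Rightarrow> pt \<Rightarrow>
    complex \<times> complex \<times> complex \<times> complex" where
  "frame_derivs f a Z Q p = (THE q. in_coframe f a Z p (ext_d Q p) q)"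

definition np_\<delta>_star :: "cfun \<Rightarrow> cfun \<Rightarrow> cfun \<Rightarrow> (pt \<Rightarrow> complex) \<Rightarrow> pt \<Rightarrow> complex" where
  "np_\<delta>_star f a Z Q p = (case frame_derivs f a Z Q p of (q1, q2, q3, q4) \<Rightarrow> q2)"

definition np_\<Delta> :: "cfun \<Rightarrow> cfun \<Rightarrow> cfun \<Rightarrow> (pt \<Rightarrow> complex) \<Rightarrow> pt \<Rightarrow> complex" where
  "np_\<Delta> f a Z Q p = (case frame_derivs f a Z Q p of (q1, q2, q3, q4) \<Rightarrow> q3)"

definition spin_\<alpha> :: "cfun \<Rightarrow> pt \<Rightarrow> complex" where
  "spin_\<alpha> a = (\<lambda>(\<zeta>, u, v). exp (a \<zeta> u - cnj (a \<zeta> u)) * cnj (dcx a \<zeta> u))"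

definition spin_\<mu> :: "cfun \<Rightarrow> cfun \<Rightarrow> pt \<Rightarrow> complex" where
  "spin_\<mu> a L = (\<lambda>(\<zeta>, u, v). exp (- a \<zeta> u - cnj (a \<zeta> u)) * dre L (a \<zeta> u) u)"

definition spin_\<nu> :: "cfun \<Rightarrow> cfun \<Rightarrow> cfun \<Rightarrow> pt \<Rightarrow> complex" where
  "spin_\<nu> f a Z = (\<lambda>(\<zeta>, u, v).
     exp (- a \<zeta> u - 3 * cnj (a \<zeta> u)) * (dre (dre Z) (a \<zeta> u) u + cnj (dcx f \<zeta> u)))"

definition inv_A :: "cfun \<Rightarrow> cfun \<Rightarrow> cfun \<Rightarrow> pt \<Rightarrow> complex" where
  "inv_A f a Z p = np_\<delta>_star f a Z (spin_\<alpha> a) p / (spin_\<alpha> a p)\<^sup>2"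

definition inv_Y :: "cfun \<Rightarrow> cfun \<Rightarrow> cfun \<Rightarrow> cfun \<Rightarrow> pt \<Rightarrow> complex" where
  "inv_Y f a Z L p =
     (3 - inv_A f a Z p) * spin_\<nu> f a Z p - 1 / spin_\<alpha> a p
     + (np_\<Delta> f a Z (spin_\<mu> a L) p + (spin_\<mu> a L p)\<^sup>2) / cnj (spin_\<alpha> a p)"

lemma pp_metric_coframe:
  "pp_metric f p \<xi> \<eta> =
     coframe1 a Z p \<xi> * coframe2 a Z p \<eta> + coframe1 a Z p \<eta> * coframe2 a Z p \<xi>
     - (coframe3 a p \<xi> * coframe4 f a Z p \<eta> + coframe3 a p \<eta> * coframe4 f a Z p \<xi>)"
proof -
  obtain \<zeta> u v where p: "p = (\<zeta>, u, v)" by (cases p)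
  define E where "E = exp (a \<zeta> u)"
  define F where "F = exp (cnj (a \<zeta> u))"
  have nz: "E \<noteq> 0" "F \<noteq> 0" by (simp_all add: E_def F_def)
  have e: "exp (a \<zeta> u - cnj (a \<zeta> u)) = E / F" "exp (cnj (a \<zeta> u) - a \<zeta> u) = F / E"
      "exp (a \<zeta> u + cnj (a \<zeta> u)) = E * F" "exp (- a \<zeta> u - cnj (a \<zeta> u)) = 1 / (E * F)"
    by (simp_all add: E_def F_def exp_diff exp_add exp_minus field_simps)
  have cc: "cnj E = F" "cnj F = E" by (simp_all add: E_def F_def exp_cnj)
  have r: "cnj (du \<xi>) = du \<xi>" "cnj (du \<eta>) = du \<eta>" by (simp_all add: du_def)
  show ?thesis
    unfolding p pp_metric_def coframe1_def coframe2_def coframe3_def coframe4_def Let_def split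
    by (simp add: e r cc) (use nz in \<open>simp add: e divide_simps\<close>, simp add: algebra_simps)
qed

lemma coframe_expansion:
  assumes "linear \<phi>"
  shows "\<exists>!q. in_coframe f a Z p \<phi> q"
proof -
  obtain \<zeta> u v where p: "p = (\<zeta>, u, v)" by (cases p)
  define c where "c = (\<phi> (1, 0, 0) - \<i> * \<phi> (\<i>, 0, 0)) / 2"
  define d where "d = (\<phi> (1, 0, 0) + \<i> * \<phi> (\<i>, 0, 0)) / 2"
  define e where "e = \<phi> (0, 1, 0)"
  define h where "h = \<phi> (0, 0, 1)"
  define P where "P = exp (a \<zeta> u - cnj (a \<zeta> u))"
  define R where "R = exp (a \<zeta> u + cnj (a \<zeta> u))"
  define S where "S = exp (- a \<zeta> u - cnj (a \<zeta> u))"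
  define W where "W = dre Z (a \<zeta> u) u"
  define V where "V = cnj W"
  define G where "G = f \<zeta> u + cnj (f \<zeta> u) + W * V"
  define P' where "P' = cnj P"
  have nz: "P \<noteq> 0" "P' \<noteq> 0" "R \<noteq> 0" "S \<noteq> 0" by (simp_all add: P_def P'_def R_def S_def)
  have \<phi>: "\<phi> (z, s, t) = c * z + d * cnj z + e * of_real s + h * of_real t" for z s t
  proof -
    have "(z, s, t) = Re z *\<^sub>R (1, 0, 0) + Im z *\<^sub>R (\<i>, 0, 0) + s *\<^sub>R (0, 1, 0) + t *\<^sub>R ((0, 0, 1)::pt)"
      by (simp add: complex_eq_iff)
    hence "\<phi> (z, s, t) = Re z *\<^sub>R \<phi> (1, 0, 0) + Im z *\<^sub>R \<phi> (\<i>, 0, 0) + s *\<^sub>R e + t *\<^sub>R h"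
      unfolding e_def h_def by (simp only: linear_add[OF assms] linear_scale[OF assms])
    thus ?thesis by (simp add: c_def d_def complex_eq_iff field_simps)
  qed
  have iff: "in_coframe f a Z p \<phi> (q1, q2, q3, q4) \<longleftrightarrow>
      (\<forall>z s t. c * z + d * cnj z + e * of_real s + h * of_real t =
         q1 * (P * (z - W * of_real s)) + q2 * (P' * (cnj z - V * of_real s)) + q3 * (R * of_real s)
         + q4 * (S * (G * of_real s + of_real t - W * cnj z - V * z)))" for q1 q2 q3 q4
    unfolding in_coframe_def p coframe1_def coframe2_def coframe3_def coframe4_def Let_def
    by (simp add: \<phi> d\<zeta>_def du_def dv_def P_def P'_def R_def S_def W_def V_def G_def)
  let ?q1 = "(c + h * V) / P" and ?q2 = "(d + h * W) / P'" and ?q4 = "h / S"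
  let ?q3 = "(e - h * G + (c + h * V) * W + (d + h * W) * V) / R"
  show ?thesis
  proof (rule ex1I)
    show "in_coframe f a Z p \<phi> (?q1, ?q2, ?q3, ?q4)"
      unfolding iff using nz by (simp add: field_simps)
  next
    fix q assume q: "in_coframe f a Z p \<phi> q"
    obtain q1 q2 q3 q4 where qq: "q = (q1, q2, q3, q4)" by (cases q)
    note * = q[unfolded qq iff, rule_format]
    have h: "h = q4 * S" using *[of 0 0 1] by simp
    have "c + d = q1 * P + q2 * P' - q4 * S * W - q4 * S * V" using *[of 1 0 0] by (simp add: algebra_simps)
    moreover have "\<i> * (c - d) = \<i> * (q1 * P - q2 * P' + q4 * S * W - q4 * S * V)"
      using *[of \<i> 0 0] by (simp add: algebra_simps)
    hence "c - d = q1 * P - q2 * P' + q4 * S * W - q4 * S * V" by (subst (asm) mult_cancel_left) simp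
    ultimately have "2 * c = 2 * (q1 * P - h * V)" "2 * d = 2 * (q2 * P' - h * W)"
      unfolding h by (algebra, algebra)
    hence "c = q1 * P - h * V" "d = q2 * P' - h * W"
      by (simp_all only: mult_cancel_left zero_neq_numeral simp_thms numeral_neq_zero)
    hence cd: "c + h * V = q1 * P" "d + h * W = q2 * P'" by simp_all
    have "e = - q1 * P * W - q2 * P' * V + q3 * R + q4 * S * G"
      using *[of 0 1 0] by (simp add: algebra_simps)
    hence "e - h * G + q1 * P * W + q2 * P' * V = q3 * R"
      unfolding h by (simp add: algebra_simps)
    hence "e - h * G + (c + h * V) * W + (d + h * W) * V = q3 * R"
      unfolding cd .
    thus "q = (?q1, ?q2, ?q3, ?q4)"
      unfolding qq using nz h cd by simp
  qed
qed

end

theory Submission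
  imports Defs
begin

text \<open>
  Since \<open>f\<^sub>\<zeta>\<^sub>\<zeta> = - e\<^sup>i\<^sup>k / \<zeta>\<^sup>2\<close>, the number \<open>c = \<zeta> e\<^sup>2\<^sup>a\<close> satisfies \<open>c\<^sup>2 = - e\<^sup>i\<^sup>k\<close>; it is locally constant of
  modulus one. Hence \<open>a\<close> and \<open>Z = c e\<^sup>-\<^sup>2\<^sup>a\<close> do not depend on \<open>u\<close>, so that \<open>\<mu> = 0\<close> and \<open>Z\<^sub>u\<^sub>u = 0\<close>. This gives
  \<open>\<alpha> = - c / (2 \<bar>\<zeta>\<bar>)\<close> and \<open>\<nu> = \<bar>\<zeta>\<bar> (c g\<^sup>* \<zeta>\<^sup>* - c\<^sup>*)\<close>, whence \<open>A = 1\<close> and \<open>Y = 2 \<nu> - 1 / \<alpha> = 2 c g\<^sup>* \<bar>\<zeta>\<bar> \<zeta>\<^sup>*\<close>.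
  As \<open>\<alpha>\<close> is a function of \<open>\<bar>\<zeta>\<bar>\<close> only, \<open>d\<alpha> \<and> d\<nu>\<close> detects the angular derivative of \<open>\<nu>\<close>, which is
  proportional to \<open>g\<^sup>*\<close>.
\<close>

section \<open>Comparing branches of logarithms; differentials and frame coefficients\<close>

text \<open>Two logarithms of one function differ by a multiple of 2 pi i, and a difference tending
  to 0 is eventually too small to be a nonzero one. The branches \<open>lg\<close>, \<open>a\<close>
  and \<open>L\<close> are all controlled through this.\<close>

lemma eventually_eq_of_exp_eq:
  fixes h k :: "'a \<Rightarrow> complex"
  assumes "(h \<longlongrightarrow> l) F" "(k \<longlongrightarrow> l) F" "\<forall>\<^sub>F x in F. exp (h x) = exp (k x)"
  shows "\<forall>\<^sub>F x in F. h x = k x"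
proof -
  have "((\<lambda>x. Im (h x) - Im (k x)) \<longlongrightarrow> Im l - Im l) F"
    by (intro tendsto_intros assms)
  hence "\<forall>\<^sub>F x in F. dist (Im (h x) - Im (k x)) 0 < 2 * pi"
    by (intro tendstoD) simp_all
  with assms(3) show ?thesis
    by eventually_elim (auto intro: exp_complex_eqI)
qed

text \<open>The quotient is near 1, away from the cut of \<open>Ln\<close>. Local formulas relative
  to z can thus use the principal branch wherever z lies.\<close>

lemma tendsto_Ln_quotient:
  assumes "z \<noteq> 0"
  shows "((\<lambda>w. Ln (w / z)) \<longlongrightarrow> 0) (nhds z)"
proof -
  have "isCont (\<lambda>w. Ln (w / z)) z"
    using assms by (intro continuous_intros) auto
  hence "((\<lambda>w. Ln (w / z)) \<longlongrightarrow> Ln (z / z)) (nhds z)"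
    unfolding isCont_def by (rule tendsto_at_iff_tendsto_nhds[THEN iffD1])
  thus ?thesis using assms by simp
qed

lemma tendsto_nhds_of_continuous_on:
  fixes h :: "'a::t2_space \<Rightarrow> 'b::topological_space"
  assumes "continuous_on S h" "open S" "x \<in> S"
  shows "(h \<longlongrightarrow> h x) (nhds x)"
proof -
  have "isCont h x"
    using assms continuous_on_eq_continuous_at by blast
  thus ?thesis
    unfolding isCont_def by (rule tendsto_at_iff_tendsto_nhds[THEN iffD1])
qed

lemma filterlim_Pair_const_left: "filterlim (\<lambda>y. (x, y)) (nhds (x, y0)) (nhds y0)"
  by (rule tendsto_Pair[OF tendsto_const filterlim_ident])

lemma filterlim_Pair_const_right: "filterlim (\<lambda>x. (x, y)) (nhds (x0, y)) (nhds x0)"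
  by (rule tendsto_Pair[OF filterlim_ident tendsto_const])

lemma vector_derivative_eventually_const:
  assumes "\<forall>\<^sub>F t in nhds u. h t = c"
  shows "vector_derivative h (at u) = 0"
  using vector_derivative_cong_eq[of UNIV h "\<lambda>_. c" u u UNIV] assms by simp

lemma ext_d_eqI:
  assumes "\<forall>\<^sub>F q in nhds p. Q q = R q" "(R has_derivative R') (at p)"
  shows "ext_d Q p = R'"
proof -
  obtain S where "open S" "p \<in> S" "\<And>q. q \<in> S \<Longrightarrow> Q q = R q"
    using assms(1) unfolding eventually_nhds by blast
  hence "(Q has_derivative R') (at p)"
    using assms(2) has_derivative_transform_within_open[of R R' p UNIV S Q] by simp
  thus ?thesis unfolding ext_d_def by (metis frechet_derivative_at)
qed

text \<open>Uniqueness of the coframe expansion resolves the definite description, so exhibiting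
  coefficients is enough.\<close>

lemma frame_derivs_eqI:
  assumes "linear (ext_d Q p)" "in_coframe f a Z p (ext_d Q p) q"
  shows "frame_derivs f a Z Q p = q"
  unfolding frame_derivs_def by (rule the1_equality[OF coframe_expansion[OF assms(1)] assms(2)])

lemma open_\<zeta>u_domain:
  assumes "open M"
  shows "open (\<zeta>u_domain M)"
proof -
  \<comment> \<open>The projection along v is the union of the slices at constant v, each a
    continuous preimage of M.\<close>
  have "\<zeta>u_domain M = (\<Union>v. (\<lambda>(z, u). (z, u, v)) -` M)"
    by (force simp: \<zeta>u_domain_def)
  moreover have "open ((\<lambda>(z, u). (z, u, v)) -` M)" for v
    by (rule open_vimage[OF assms]) (auto simp: case_prod_unfold intro!: continuous_intros)
  ultimately show ?thesis by auto
qed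

section \<open>The logarithmic wave and its derivatives in \<zeta>\<close>

locale log_pp_wave =
  fixes M :: "pt set" and f a Z L :: cfun and lg :: "complex \<Rightarrow> complex"
    and g :: "real \<Rightarrow> complex" and k :: real
  assumes wave: "vacuum_pp_wave M f"
    and cont_lg: "continuous_on (fst ` M) lg"
    and exp_lg: "\<And>\<zeta>. \<zeta> \<in> fst ` M \<Longrightarrow> exp (lg \<zeta>) = \<zeta>"
    and f_eq: "\<And>\<zeta> u v. (\<zeta>, u, v) \<in> M \<Longrightarrow> f \<zeta> u = exp (\<i> * of_real k) * lg \<zeta> + g u * \<zeta>"
    and data: "pp_wave_data M f a Z L"
begin

abbreviation "D \<equiv> \<zeta>u_domain M"
abbreviation "e \<equiv> exp (\<i> * of_real k)"

lemma open_M: "open M"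
  using wave by (simp add: vacuum_pp_wave_def)

lemma open_D: "open D"
  by (rule open_\<zeta>u_domain[OF open_M])

lemma DI: "(z, u, v) \<in> M \<Longrightarrow> (z, u) \<in> D"
  unfolding \<zeta>u_domain_def by force

lemma DE:
  assumes "(z, u) \<in> D"
  obtains v where "(z, u, v) \<in> M"
  using assms unfolding \<zeta>u_domain_def by auto

lemma nonzero: "(z, u) \<in> D \<Longrightarrow> z \<noteq> 0"
  using wave unfolding vacuum_pp_wave_def by (auto elim!: DE)

lemma fst_DI: "(z, u) \<in> D \<Longrightarrow> z \<in> fst ` M"
  by (force elim!: DE)

lemma f_eq_D: "(z, u) \<in> D \<Longrightarrow> f z u = e * lg z + g u * z"
  using f_eq by (auto elim!: DE)

lemma eventually_D: "(z, u) \<in> D \<Longrightarrow> \<forall>\<^sub>F q in nhds (z, u). q \<in> D"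
  by (rule eventually_nhds_in_open[OF open_D])

lemma eventually_D_fst: "(z, u) \<in> D \<Longrightarrow> \<forall>\<^sub>F w in nhds z. (w, u) \<in> D"
  by (rule eventually_compose_filterlim[OF eventually_D filterlim_Pair_const_right])

lemma eventually_D_snd: "(z, u) \<in> D \<Longrightarrow> \<forall>\<^sub>F t in nhds u. (z, t) \<in> D"
  by (rule eventually_compose_filterlim[OF eventually_D filterlim_Pair_const_left])

text \<open>Both sides are logarithms of w that tend to \<open>lg z\<close> at z. This makes an
  arbitrary continuous branch differentiable.\<close>

lemma eventually_lg:
  assumes "(z, u) \<in> D"
  shows "\<forall>\<^sub>F w in nhds z. lg w = lg z + Ln (w / z)"
proof (rule eventually_eq_of_exp_eq)
  have "open (fst ` M)" by (rule open_image_fst[OF open_M])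
  thus "(lg \<longlongrightarrow> lg z) (nhds z)"
    by (rule tendsto_nhds_of_continuous_on[OF cont_lg _ fst_DI[OF assms]])
  show "((\<lambda>w. lg z + Ln (w / z)) \<longlongrightarrow> lg z) (nhds z)"
    using tendsto_add[OF tendsto_const tendsto_Ln_quotient[OF nonzero[OF assms]], of "lg z"] by simp
  show "\<forall>\<^sub>F w in nhds z. exp (lg w) = exp (lg z + Ln (w / z))"
    using eventually_D_fst[OF assms]
    by eventually_elim
      (use assms in \<open>simp add: exp_add exp_lg fst_DI nonzero\<close>)
qed

lemma dcx_f:
  assumes "(z, u) \<in> D"
  shows "dcx f z u = e / z + g u"
proof -
  have "\<forall>\<^sub>F w in nhds z. f w u = e * (lg z + Ln (w / z)) + g u * w"
    using eventually_D_fst[OF assms] eventually_lg[OF assms] by eventually_elim (simp add: f_eq_D)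
  hence "dcx f z u = deriv (\<lambda>w. e * (lg z + Ln (w / z)) + g u * w) z"
    unfolding dcx_def by (rule deriv_cong_ev) simp
  also have "\<dots> = e / z + g u"
    using nonzero[OF assms] by (intro DERIV_imp_deriv) (auto intro!: derivative_eq_intros)
  finally show ?thesis .
qed

lemma dcx_dcx_f:
  assumes "(z, u) \<in> D"
  shows "dcx (dcx f) z u = - e / z\<^sup>2"
proof -
  have "\<forall>\<^sub>F w in nhds z. dcx f w u = e / w + g u"
    using eventually_D_fst[OF assms] by eventually_elim (rule dcx_f)
  hence "dcx (dcx f) z u = deriv (\<lambda>w. e / w + g u) z"
    unfolding dcx_def[of "dcx f"] by (rule deriv_cong_ev) simp
  also have "\<dots> = - e / z\<^sup>2"
    using nonzero[OF assms]
    by (intro DERIV_imp_deriv) (auto intro!: derivative_eq_intros simp: power2_eq_square)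
  finally show ?thesis .
qed

section \<open>The branch \<open>a\<close>, its inverse \<open>Z\<close>, and
  \<open>L\<close>\<close>

lemma exp_a: "(z, u) \<in> D \<Longrightarrow> exp (4 * a z u) = - e / z\<^sup>2"
  using data dcx_dcx_f[of z u] by (auto simp: pp_wave_data_def)

lemma Z_a: "(z, u) \<in> D \<Longrightarrow> Z (a z u) u = z"
  using data by (auto simp: pp_wave_data_def)

lemma tendsto_a:
  assumes "(z, u) \<in> D"
  shows "((\<lambda>q. a (fst q) (snd q)) \<longlongrightarrow> a z u) (nhds (z, u))"
proof -
  have "continuous_on D (\<lambda>(z, u). a z u)"
    using data unfolding pp_wave_data_def by blast
  from tendsto_nhds_of_continuous_on[OF this open_D assms] show ?thesis
    by (simp add: case_prod_unfold)
qed

text \<open>Four times each side is a logarithm of the second derivative -e / w^2, with the same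
  limit at (z, u). The right side does not involve the real coordinate, which is the source of all
  u-independence below.\<close>

lemma eventually_a:
  assumes "(z, u) \<in> D"
  shows "\<forall>\<^sub>F q in nhds (z, u). a (fst q) (snd q) = a z u - Ln (fst q / z) / 2"
proof -
  have nz: "z \<noteq> 0" using nonzero[OF assms] .
  have Ln: "((\<lambda>q. Ln (fst q / z)) \<longlongrightarrow> 0) (nhds (z, u))"
    by (rule filterlim_compose[OF tendsto_Ln_quotient[OF nz]])
      (use tendsto_fst[OF filterlim_ident, of "(z, u)"] in simp)
  have "\<forall>\<^sub>F q in nhds (z, u). 4 * a (fst q) (snd q) = 4 * a z u - 2 * Ln (fst q / z)"
  proof (rule eventually_eq_of_exp_eq)
    show "((\<lambda>q. 4 * a (fst q) (snd q)) \<longlongrightarrow> 4 * a z u) (nhds (z, u))"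
      by (intro tendsto_intros tendsto_a assms)
    show "((\<lambda>q. 4 * a z u - 2 * Ln (fst q / z)) \<longlongrightarrow> 4 * a z u) (nhds (z, u))"
      by (rule tendsto_eq_intros Ln refl)+ simp
    show "\<forall>\<^sub>F q in nhds (z, u).
        exp (4 * a (fst q) (snd q)) = exp (4 * a z u - 2 * Ln (fst q / z))"
      using eventually_D[OF assms]
    proof eventually_elim
      case (elim q)
      obtain w t where q: "q = (w, t)" by (cases q)
      have "exp (2 * Ln (w / z)) = (w / z)\<^sup>2"
        using nonzero[of w t] nz elim q by (simp add: exp_double)
      thus ?case
        using exp_a[OF assms] exp_a[of w t] nonzero[of w t] nz elim q
        by (simp add: exp_diff power_divide)
    qed
  qed
  thus ?thesis
  proof eventually_elim
    case (elim q)
    have "a (fst q) (snd q) = (4 * a (fst q) (snd q)) / 4" by simp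
    also have "\<dots> = a z u - Ln (fst q / z) / 2"
      unfolding elim by (simp add: diff_divide_distrib)
    finally show ?case .
  qed
qed

lemma eventually_a_fst:
  "(z, u) \<in> D \<Longrightarrow> \<forall>\<^sub>F w in nhds z. a w u = a z u - Ln (w / z) / 2"
  using eventually_compose_filterlim[OF eventually_a filterlim_Pair_const_right] by simp

lemma eventually_a_snd:
  assumes "(z, u) \<in> D"
  shows "\<forall>\<^sub>F t in nhds u. a z t = a z u"
  using eventually_compose_filterlim[OF eventually_a[OF assms] filterlim_Pair_const_left]
    nonzero[OF assms] by simp

lemma dcx_a:
  assumes "(z, u) \<in> D"
  shows "dcx a z u = - 1 / (2 * z)"
proof -
  have "dcx a z u = deriv (\<lambda>w. a z u - Ln (w / z) / 2) z"
    unfolding dcx_def by (rule deriv_cong_ev[OF eventually_a_fst[OF assms]]) simp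
  also have "\<dots> = - 1 / (2 * z)"
    using nonzero[OF assms]
    by (intro DERIV_imp_deriv) (auto intro!: derivative_eq_intros)
  finally show ?thesis .
qed

text \<open>\<open>Z\<close> is prescribed only at values of \<open>a\<close>, so these must first
  be shown to fill a neighbourhood of \<open>a z u\<close>.\<close>

lemma dcx_Z:
  assumes "(z, u) \<in> D"
  shows "dcx Z (a z u) u = - 2 * z"
proof -
  \<comment> \<open>\<open>?w b\<close> solves b = a(z, u) - Ln (w / z) / 2 for w, up to the choice
    of branch.\<close>
  let ?b = "a z u" and ?w = "\<lambda>b. z * exp (- 2 * (b - a z u))"
  have nz: "z \<noteq> 0" using nonzero[OF assms] .
  have lim: "filterlim ?w (nhds z) (nhds ?b)"
    by (rule tendsto_eq_intros filterlim_ident refl)+ simp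
  have "\<forall>\<^sub>F b in nhds ?b. Ln (?w b / z) = - 2 * (b - ?b)"
  proof (rule eventually_eq_of_exp_eq)
    show "((\<lambda>b. Ln (?w b / z)) \<longlongrightarrow> 0) (nhds ?b)"
      by (rule filterlim_compose[OF tendsto_Ln_quotient[OF nz] lim])
    show "((\<lambda>b. - 2 * (b - ?b)) \<longlongrightarrow> 0) (nhds ?b)"
      by (rule tendsto_eq_intros filterlim_ident refl)+ simp
  qed (use nz in simp)
  moreover have "\<forall>\<^sub>F b in nhds ?b. (?w b, u) \<in> D \<and> a (?w b) u = ?b - Ln (?w b / z) / 2"
    by (intro eventually_conj eventually_compose_filterlim[OF _ lim]
        eventually_D_fst[OF assms] eventually_a_fst[OF assms])
  ultimately have "\<forall>\<^sub>F b in nhds ?b. Z b u = ?w b"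
  proof eventually_elim
    case (elim b)
    hence "a (?w b) u = b" by (simp add: diff_divide_distrib)
    with Z_a[of "?w b" u] elim show ?case by simp
  qed
  hence "dcx Z ?b u = deriv ?w ?b"
    unfolding dcx_def by (rule deriv_cong_ev) simp
  also have "\<dots> = - 2 * z"
    by (intro DERIV_imp_deriv) (auto intro!: derivative_eq_intros)
  finally show ?thesis .
qed

lemma eventually_a_snd_D:
  assumes "(z, u) \<in> D"
  shows "\<forall>\<^sub>F t in nhds u. (z, t) \<in> D \<and> a z t = a z u"
  by (intro eventually_conj eventually_a_snd eventually_D_snd assms)

text \<open>Fixing \<open>a\<close> amounts locally to fixing \<zeta>:
  \<open>Z (a z u) t = Z (a z t) t = z\<close> for t near u.\<close>

lemma dre_Z:
  assumes "(z, u) \<in> D"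
  shows "dre Z (a z u) u = 0"
proof -
  have "\<forall>\<^sub>F t in nhds u. Z (a z u) t = z"
    using eventually_a_snd_D[OF assms] by eventually_elim (metis Z_a)
  thus ?thesis unfolding dre_def by (rule vector_derivative_eventually_const)
qed

lemma dre_dre_Z:
  assumes "(z, u) \<in> D"
  shows "dre (dre Z) (a z u) u = 0"
proof -
  have "\<forall>\<^sub>F t in nhds u. dre Z (a z u) t = 0"
    using eventually_a_snd_D[OF assms] by eventually_elim (metis dre_Z)
  thus ?thesis unfolding dre_def[of "dre Z"] by (rule vector_derivative_eventually_const)
qed

lemma exp_L: "(z, u) \<in> D \<Longrightarrow> exp (L (a z u) u) = - 2 * z"
  using data dcx_Z[of z u] by (auto simp: pp_wave_data_def)

text \<open>Along t at fixed z, \<open>L (a z t) t\<close> is a continuous logarithm of the constant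
  -2z, hence locally constant; \<open>a z t\<close> is locally constant too.\<close>

lemma dre_L:
  assumes "(z, u) \<in> D"
  shows "dre L (a z u) u = 0"
proof -
  \<comment> \<open>Continuity of \<open>L\<close> is given only on the image of \<open>D\<close>;
    composing with the map onto it transfers this to the open set \<open>D\<close>.\<close>
  have "continuous_on D (\<lambda>q. (a (fst q) (snd q), snd q))"
    using data unfolding pp_wave_data_def
    by (auto simp: case_prod_unfold intro!: continuous_intros)
  moreover have "continuous_on ((\<lambda>q. (a (fst q) (snd q), snd q)) ` D) (\<lambda>q. L (fst q) (snd q))"
    using data unfolding pp_wave_data_def by (auto simp: case_prod_unfold)
  ultimately have "continuous_on D (\<lambda>q. L (a (fst q) (snd q)) (snd q))"
    using continuous_on_compose[of D "\<lambda>q. (a (fst q) (snd q), snd q)" "\<lambda>q. L (fst q) (snd q)"]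
    by (simp add: o_def)
  from tendsto_nhds_of_continuous_on[OF this open_D assms]
  have "((\<lambda>t. L (a z t) t) \<longlongrightarrow> L (a z u) u) (nhds u)"
    using filterlim_compose[OF _ filterlim_Pair_const_left] by fastforce
  hence "\<forall>\<^sub>F t in nhds u. L (a z t) t = L (a z u) u"
  proof (rule eventually_eq_of_exp_eq)
    show "\<forall>\<^sub>F t in nhds u. exp (L (a z t) t) = exp (L (a z u) u)"
      using eventually_D_snd[OF assms] by eventually_elim (simp add: exp_L assms)
  qed simp
  with eventually_a_snd[OF assms] have "\<forall>\<^sub>F t in nhds u. L (a z u) t = L (a z u) u"
    by eventually_elim simp
  thus ?thesis unfolding dre_def by (rule vector_derivative_eventually_const)
qed

text \<open>The locally constant number \<open>c\<close> above.\<close>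
definition phase :: cfun where "phase z u = z * exp (2 * a z u)"

lemma phase_square:
  assumes "(z, u) \<in> D"
  shows "(phase z u)\<^sup>2 = - e"
proof -
  have "(phase z u)\<^sup>2 = z\<^sup>2 * exp (4 * a z u)"
    by (simp add: phase_def power_mult_distrib flip: exp_double)
  thus ?thesis using exp_a[OF assms] nonzero[OF assms] by simp
qed

lemma norm_phase:
  assumes "(z, u) \<in> D"
  shows "cmod (phase z u) = 1"
proof -
  have "(cmod (phase z u))\<^sup>2 = 1"
    by (simp add: phase_square[OF assms] flip: norm_power)
  thus ?thesis by (simp add: power2_eq_1_iff) (smt (verit) norm_ge_zero)
qed

lemma phase_cnj: "(z, u) \<in> D \<Longrightarrow> phase z u * cnj (phase z u) = 1"
  by (simp add: norm_phase complex_norm_square[symmetric])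

text \<open>Moving from z to w multiplies \<open>exp (2 * a)\<close> by z / w, which cancels the
  change of the prefactor.\<close>

lemma eventually_phase:
  assumes "(z, u) \<in> D"
  shows "\<forall>\<^sub>F q in nhds (z, u). phase (fst q) (snd q) = phase z u"
  using eventually_a[OF assms] eventually_D[OF assms]
proof eventually_elim
  case (elim q)
  hence "fst q \<noteq> 0" using nonzero[of "fst q" "snd q"] by simp
  with elim nonzero[OF assms] show ?case by (simp add: phase_def exp_diff)
qed

section \<open>Closed forms of the spin coefficients\<close>

text \<open>The sum of \<open>a\<close> and its conjugate is twice its real part, and the modulus of
  the phase being 1 fixes that.\<close>

lemma exp_a_add:
  assumes "(z, u) \<in> D"
  shows "exp (a z u + cnj (a z u)) = 1 / cmod z"
proof -
  have "cmod z * exp (2 * Re (a z u)) = 1"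
    using norm_phase[OF assms] by (simp add: phase_def norm_mult)
  hence "exp (2 * Re (a z u)) = 1 / cmod z"
    using nonzero[OF assms] by (simp add: field_simps)
  moreover have "exp (a z u + cnj (a z u)) = of_real (exp (2 * Re (a z u)))"
    by (simp add: complex_add_cnj flip: exp_of_real)
  ultimately show ?thesis by simp
qed

lemma exp_a_diff:
  assumes "(z, u) \<in> D"
  shows "exp (a z u - cnj (a z u)) = phase z u * cmod z / z"
proof -
  have "exp (a z u - cnj (a z u)) = exp (2 * a z u) / exp (a z u + cnj (a z u))"
    by (simp flip: exp_diff)
  thus ?thesis using nonzero[OF assms] by (simp add: exp_a_add[OF assms] phase_def)
qed

lemma spin_\<alpha>_eq:
  assumes "(z, u, v) \<in> M"
  shows "spin_\<alpha> a (z, u, v) = - phase z u / (2 * cmod z)"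
proof -
  have zz: "z * cnj z = of_real (cmod z) * of_real (cmod z)"
    by (simp add: complex_norm_square[symmetric] power2_eq_square)
  show ?thesis
    using nonzero[OF DI[OF assms]]
    by (simp add: spin_\<alpha>_def exp_a_diff[OF DI[OF assms]] dcx_a[OF DI[OF assms]] field_simps zz)
qed

lemma spin_\<mu>_eq: "(z, u, v) \<in> M \<Longrightarrow> spin_\<mu> a L (z, u, v) = 0"
  by (simp add: spin_\<mu>_def dre_L[OF DI])

lemma spin_\<nu>_eq:
  assumes "(z, u, v) \<in> M"
  shows "spin_\<nu> f a Z (z, u, v) =
    cmod z * (phase z u * cnj (g u) * cnj z - cnj (phase z u))"
proof -
  note D = DI[OF assms]
  have nz: "z \<noteq> 0" using nonzero[OF D] .
  let ?c = "phase z u"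
  have cc: "?c * cnj ?c = 1" by (rule phase_cnj[OF D])
  hence c0: "?c \<noteq> 0" by auto
  have ce: "cnj e = - (cnj ?c)\<^sup>2"
    using arg_cong[OF phase_square[OF D], of cnj] by simp
  have "exp (- a z u - 3 * cnj (a z u)) = inverse (exp (a z u + cnj (a z u)) * cnj (exp (2 * a z u)))"
    by (simp add: exp_cnj algebra_simps flip: exp_add exp_minus)
  also have "exp (2 * a z u) = ?c / z"
    using nz by (simp add: phase_def)
  also have "inverse (exp (a z u + cnj (a z u)) * cnj (?c / z)) = cmod z * cnj z / cnj ?c"
    by (simp add: exp_a_add[OF D])
  also have "\<dots> = cmod z * cnj z * ?c"
    using cc c0 by (simp add: field_simps)
  finally have ex: "exp (- a z u - 3 * cnj (a z u)) = cmod z * cnj z * ?c" .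
  have "spin_\<nu> f a Z (z, u, v) = cmod z * cnj z * ?c * (- (cnj ?c)\<^sup>2 / cnj z + cnj (g u))"
    by (simp only: spin_\<nu>_def split dre_dre_Z[OF D] dcx_f[OF D] ex complex_cnj_add
        complex_cnj_divide ce add_0_left)
  also have "\<dots> = cmod z * (?c * cnj (g u) * cnj z - (?c * cnj ?c) * cnj ?c)"
    using nz by (simp add: field_simps power2_eq_square)
  finally show ?thesis using cc by simp
qed

section \<open>Differentials of \<alpha> and \<nu>, and the invariant Y\<close>

lemma tendsto_\<zeta>u: "filterlim (\<lambda>q. (fst q, fst (snd q))) (nhds (z, u)) (nhds (z, u, v))"
  using tendsto_Pair[OF tendsto_fst[OF filterlim_ident] tendsto_fst[OF tendsto_snd[OF filterlim_ident]],
    of "(z, u, v)"]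
  by simp

lemma eventually_M_phase:
  assumes "(z, u, v) \<in> M"
  shows "\<forall>\<^sub>F q in nhds (z, u, v). q \<in> M \<and> phase (fst q) (fst (snd q)) = phase z u"
  using eventually_compose_filterlim[OF eventually_phase[OF DI[OF assms]] tendsto_\<zeta>u, of v]
    eventually_nhds_in_open[OF open_M assms]
  by eventually_elim simp

text \<open>\<open>g\<close> inherits its regularity from \<open>f\<close>.\<close>
lemma g_differentiable:
  assumes "(z, u) \<in> D"
  obtains G where "(g has_vector_derivative G) (at u)"
proof -
  have "higher_differentiable 1 (\<lambda>(\<zeta>, u). f \<zeta> u) D"
    using wave unfolding vacuum_pp_wave_def smooth_def by blast
  then obtain F where "((\<lambda>(\<zeta>, u). f \<zeta> u) has_derivative F) (at (z, u))"
    using assms unfolding differentiable_def One_nat_def higher_differentiable.simps by blast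
  \<comment> \<open>Restriction of f to the line of constant \<zeta> = z, on which g is recovered by
    subtracting the logarithm and dividing by z.\<close>
  hence "((\<lambda>t. f z t) has_derivative (\<lambda>h. F (0, h))) (at u)"
    using has_derivative_compose[OF has_derivative_Pair[OF has_derivative_const has_derivative_ident],
        where g = "\<lambda>(\<zeta>, u). f \<zeta> u"]
    by simp
  hence "(\<lambda>t. f z t) differentiable at u"
    unfolding differentiable_def by blast
  then obtain F' where "((\<lambda>t. f z t) has_vector_derivative F') (at u)"
    by (meson vector_derivative_works)
  hence d: "((\<lambda>t. (f z t - e * lg z) / z) has_vector_derivative F' / z) (at u)"
    by (auto intro!: derivative_eq_intros)
  have ev: "\<forall>\<^sub>F t in nhds u. (f z t - e * lg z) / z = g t"
    using eventually_D_snd[OF assms]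
    by eventually_elim (use nonzero[OF assms] in \<open>simp add: f_eq_D\<close>)
  have "(g has_vector_derivative F' / z) (at u)"
    using d ev eventually_nhds_x_imp_x[OF ev]
      has_vector_derivative_cong_ev[where x = u and S = UNIV and f = "\<lambda>t. (f z t - e * lg z) / z" and g = g] by auto
  thus thesis by (rule that)
qed

text \<open>The differential of \<open>\<bar>\<zeta>\<bar>\<close>.\<close>
definition dr :: "complex \<Rightarrow> form" where
  "dr z \<xi> = (cnj z * fst \<xi> + z * cnj (fst \<xi>)) / (2 * cmod z)"

lemma has_derivative_cmod_fst:
  assumes "z \<noteq> 0"
  shows "((\<lambda>q::pt. complex_of_real (cmod (fst q))) has_derivative dr z) (at (z, u, v))"
proof -
  have 1: "((\<lambda>q::pt. cmod (fst q)) has_derivative (\<lambda>\<xi>. inner (fst \<xi>) (sgn z))) (at (z, u, v))"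
    using has_derivative_compose[OF has_derivative_fst[OF has_derivative_ident]
        has_derivative_norm, of "(z, u, v)" UNIV] assms by simp
  have "dr z = (\<lambda>\<xi>. of_real (inner (fst \<xi>) (sgn z)))"
    using assms
    by (auto simp: dr_def fun_eq_iff complex_eq_iff inner_complex_def sgn_eq field_simps)
  thus ?thesis
    using has_derivative_of_real[OF 1] by simp
qed

text \<open>With the phase locally constant, \<alpha> is a constant multiple of the reciprocal of
  the modulus, so its differential is proportional to \<open>dr z\<close>.\<close>

lemma ext_d_spin_\<alpha>:
  assumes "(z, u, v) \<in> M"
  shows "ext_d (spin_\<alpha> a) (z, u, v) = (\<lambda>\<xi>. phase z u / (2 * (cmod z)\<^sup>2) * dr z \<xi>)"
proof (rule ext_d_eqI)
  show "\<forall>\<^sub>F q in nhds (z, u, v). spin_\<alpha> a q = - phase z u / 2 * inverse (complex_of_real (cmod (fst q)))"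
    using eventually_M_phase[OF assms]
    by eventually_elim (auto simp: spin_\<alpha>_eq field_simps)
  have nz: "z \<noteq> 0" using nonzero[OF DI[OF assms]] .
  show "((\<lambda>q. - phase z u / 2 * inverse (complex_of_real (cmod (fst q)))) has_derivative
      (\<lambda>\<xi>. phase z u / (2 * (cmod z)\<^sup>2) * dr z \<xi>)) (at (z, u, v))"
    by (rule has_derivative_eq_rhs[OF has_derivative_mult_right[OF
          Deriv.has_derivative_inverse[OF _ has_derivative_cmod_fst[OF nz]]]])
      (use nz in \<open>auto simp: fun_eq_iff field_simps power2_eq_square\<close>)
qed

lemma np_\<delta>_star_spin_\<alpha>:
  assumes "(z, u, v) \<in> M"
  shows "np_\<delta>_star f a Z (spin_\<alpha> a) (z, u, v) = (spin_\<alpha> a (z, u, v))\<^sup>2"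
proof -
  note D = DI[OF assms]
  let ?c = "phase z u" and ?r = "complex_of_real (cmod z)"
  have nz: "z \<noteq> 0" using nonzero[OF D] .
  have c0: "?c \<noteq> 0" using norm_phase[OF D] by auto
  have cc: "cnj ?c = 1 / ?c" using phase_cnj[OF D] c0 by (simp add: field_simps)
  have zz: "z * cnj z = ?r * ?r"
    by (simp add: complex_norm_square[symmetric] power2_eq_square)
  \<comment> \<open>Obtained by substituting d\<zeta> = z / (c r) \<omega>^1 and its conjugate into
    c / (2 r^2) dr, with c the phase and r the modulus; \<open>?q2\<close> equals
    \<alpha>^2.\<close>
  let ?q1 = "1 / (4 * ?r\<^sup>2)" and ?q2 = "?c\<^sup>2 / (4 * ?r\<^sup>2)"
  have "in_coframe f a Z (z, u, v) (ext_d (spin_\<alpha> a) (z, u, v)) (?q1, ?q2, 0, 0)"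
    unfolding in_coframe_def split
  proof
    fix \<xi> :: pt
    have "coframe1 a Z (z, u, v) \<xi> = ?c * ?r / z * fst \<xi>"
      by (simp add: coframe1_def dre_Z[OF D] d\<zeta>_def exp_a_diff[OF D])
    moreover have "coframe2 a Z (z, u, v) \<xi> = ?r / (?c * cnj z) * cnj (fst \<xi>)"
      by (simp add: coframe2_def calculation cc)
    moreover have "?c / (2 * ?r\<^sup>2) * dr z \<xi> =
        ?q1 * (?c * ?r / z * fst \<xi>) + ?q2 * (?r / (?c * cnj z) * cnj (fst \<xi>))"
    proof -
      have i: "cnj z = ?r * ?r / z" using zz nz by (simp add: field_simps)
      show ?thesis
        unfolding dr_def i using nz c0 by (simp add: field_simps power2_eq_square)
    qed
    ultimately show "ext_d (spin_\<alpha> a) (z, u, v) \<xi> =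
        ?q1 * coframe1 a Z (z, u, v) \<xi> + ?q2 * coframe2 a Z (z, u, v) \<xi>
        + 0 * coframe3 a (z, u, v) \<xi> + 0 * coframe4 f a Z (z, u, v) \<xi>"
      by (simp add: ext_d_spin_\<alpha>[OF assms])
  qed
  moreover have "linear (ext_d (spin_\<alpha> a) (z, u, v))"
    unfolding ext_d_spin_\<alpha>[OF assms]
    by (intro bounded_linear.linear bounded_linear_const_mult
        has_derivative_bounded_linear[OF has_derivative_cmod_fst[OF nz]])
  ultimately have "frame_derivs f a Z (spin_\<alpha> a) (z, u, v) = (?q1, ?q2, 0, 0)"
    by (intro frame_derivs_eqI)
  thus ?thesis by (simp add: np_\<delta>_star_def spin_\<alpha>_eq[OF assms] power_divide power_mult_distrib)
qed

lemma np_\<Delta>_spin_\<mu>: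
  assumes "(z, u, v) \<in> M"
  shows "np_\<Delta> f a Z (spin_\<mu> a L) (z, u, v) = 0"
proof -
  have "\<forall>\<^sub>F q in nhds (z, u, v). spin_\<mu> a L q = 0"
    using eventually_M_phase[OF assms] by eventually_elim (auto simp: spin_\<mu>_eq)
  hence d: "ext_d (spin_\<mu> a L) (z, u, v) = (\<lambda>_. 0)"
    by (rule ext_d_eqI) simp
  have "frame_derivs f a Z (spin_\<mu> a L) (z, u, v) = (0, 0, 0, 0)"
    by (rule frame_derivs_eqI) (simp_all add: d in_coframe_def linear_zero)
  thus ?thesis by (simp add: np_\<Delta>_def)
qed

text \<open>Here A = 1 and the \<mu> terms vanish, leaving 2 \<nu> - 1 / \<alpha>. The g-free part
  of 2 \<nu> cancels against 1 / \<alpha>, because the phase has modulus one.\<close>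

lemma inv_Y_eq:
  assumes "(z, u, v) \<in> M"
  shows "inv_Y f a Z L (z, u, v) = 2 * cmod z * phase z u * cnj (g u) * cnj z"
proof -
  note D = DI[OF assms]
  have nz: "z \<noteq> 0" using nonzero[OF D] .
  have c0: "phase z u \<noteq> 0" using norm_phase[OF D] by auto
  have cc: "cnj (phase z u) = 1 / phase z u" using phase_cnj[OF D] c0 by (simp add: field_simps)
  have "spin_\<alpha> a (z, u, v) \<noteq> 0" using c0 nz by (simp add: spin_\<alpha>_eq[OF assms])
  hence "inv_A f a Z (z, u, v) = 1"
    by (simp add: inv_A_def np_\<delta>_star_spin_\<alpha>[OF assms])
  thus ?thesis
    using c0 nz
    by (simp add: inv_Y_def np_\<Delta>_spin_\<mu>[OF assms] spin_\<mu>_eq[OF assms] spin_\<nu>_eq[OF assms]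
        spin_\<alpha>_eq[OF assms] cc field_simps)
qed

lemma inv_Y_eq_0_iff:
  assumes "(z, u, v) \<in> M"
  shows "inv_Y f a Z L (z, u, v) = 0 \<longleftrightarrow> g u = 0"
  using nonzero[OF DI[OF assms]] norm_phase[OF DI[OF assms]] by (auto simp: inv_Y_eq[OF assms])

text \<open>\<open>G\<close> is the conjugate of the derivative of g. It may stay unspecified, since
  the vectors used for testing have no u-component.\<close>

lemma ext_d_spin_\<nu>:
  assumes "(z, u, v) \<in> M"
  obtains G where "ext_d (spin_\<nu> f a Z) (z, u, v) = (\<lambda>\<xi>.
      (phase z u * cnj (g u) * cnj z - cnj (phase z u)) * dr z \<xi>
      + cmod z * phase z u * (cnj (g u) * cnj (fst \<xi>) + cnj z * G * du \<xi>))"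
proof -
  note D = DI[OF assms]
  let ?c = "phase z u"
  have nz: "z \<noteq> 0" using nonzero[OF D] .
  obtain G where G: "(g has_vector_derivative G) (at u)"
    using g_differentiable[OF D] .
  have g: "((\<lambda>q::pt. g (fst (snd q))) has_derivative (\<lambda>\<xi>. fst (snd \<xi>) *\<^sub>R G)) (at (z, u, v))"
    using has_derivative_compose[OF has_derivative_fst[OF has_derivative_snd[OF has_derivative_ident]],
        where g = g and x = "(z, u, v)"] G
    by (simp add: has_vector_derivative_def)
  show thesis
  proof (rule that, rule ext_d_eqI)
    show "\<forall>\<^sub>F q in nhds (z, u, v). spin_\<nu> f a Z q =
        complex_of_real (cmod (fst q)) * (?c * cnj (g (fst (snd q))) * cnj (fst q) - cnj ?c)"
      using eventually_M_phase[OF assms] by eventually_elim (auto simp: spin_\<nu>_eq)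
    show "((\<lambda>q. complex_of_real (cmod (fst q)) * (?c * cnj (g (fst (snd q))) * cnj (fst q) - cnj ?c))
        has_derivative (\<lambda>\<xi>. (?c * cnj (g u) * cnj z - cnj ?c) * dr z \<xi>
          + cmod z * ?c * (cnj (g u) * cnj (fst \<xi>) + cnj z * cnj G * du \<xi>))) (at (z, u, v))"
      by (rule derivative_eq_intros has_derivative_cmod_fst nz g refl)+
        (auto simp: fun_eq_iff du_def scaleR_conv_of_real algebra_simps)
  qed
qed

section \<open>Vanishing of the wedge product\<close>

lemma wedge_eq_0_imp:
  assumes "(z, u, v) \<in> M"
    and "\<And>\<xi> \<eta>. wedge (ext_d (spin_\<alpha> a) (z, u, v)) (ext_d (spin_\<nu> f a Z) (z, u, v)) \<xi> \<eta> = 0"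
  shows "g u = 0"
proof -
  note D = DI[OF assms(1)]
  have nz: "z \<noteq> 0" using nonzero[OF D] .
  have c0: "phase z u \<noteq> 0" using norm_phase[OF D] by auto
  obtain G where \<nu>: "ext_d (spin_\<nu> f a Z) (z, u, v) = (\<lambda>\<xi>.
      (phase z u * cnj (g u) * cnj z - cnj (phase z u)) * dr z \<xi>
      + cmod z * phase z u * (cnj (g u) * cnj (fst \<xi>) + cnj z * G * du \<xi>))"
    using ext_d_spin_\<nu>[OF assms(1)] .
  \<comment> \<open>Test on the radial and the angular direction: \<open>\<alpha>\<close> depends on \<open>\<bar>\<zeta>\<bar>\<close> only.\<close>
  have "dr z (\<i> * z, 0, 0) = 0" "dr z (z, 0, 0) \<noteq> 0"
    using nz by (simp_all add: dr_def)
  \<comment> \<open>Only the radial value of d\<alpha> times the angular value of d\<nu> survives;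
    the latter is the conjugate of g times a nonzero factor.\<close>
  thus ?thesis
    using assms(2)[of "(z, 0, 0)" "(\<i> * z, 0, 0)"] nz c0
    by (simp add: wedge_def ext_d_spin_\<alpha>[OF assms(1)] \<nu> du_def)
qed

text \<open>With g = 0 both differentials are multiples of \<open>dr z\<close>. The hypothesis
  covers all of M because differentiating \<nu> needs its closed form on a neighbourhood.\<close>

lemma wedge_eq_0:
  assumes "(z, u, v) \<in> M" and g0: "\<And>z u v. (z, u, v) \<in> M \<Longrightarrow> g u = 0"
  shows "wedge (ext_d (spin_\<alpha> a) (z, u, v)) (ext_d (spin_\<nu> f a Z) (z, u, v)) \<xi> \<eta> = 0"
proof -
  have nz: "z \<noteq> 0" using nonzero[OF DI[OF assms(1)]] .
  have "ext_d (spin_\<nu> f a Z) (z, u, v) = (\<lambda>\<xi>. - cnj (phase z u) * dr z \<xi>)"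
  proof (rule ext_d_eqI)
    show "\<forall>\<^sub>F q in nhds (z, u, v). spin_\<nu> f a Z q =
        - cnj (phase z u) * complex_of_real (cmod (fst q))"
      using eventually_M_phase[OF assms(1)] by eventually_elim (auto simp: spin_\<nu>_eq g0)
    show "((\<lambda>q. - cnj (phase z u) * complex_of_real (cmod (fst q))) has_derivative
        (\<lambda>\<xi>. - cnj (phase z u) * dr z \<xi>)) (at (z, u, v))"
      by (intro has_derivative_mult_right has_derivative_cmod_fst nz)
  qed
  thus ?thesis by (simp add: wedge_def ext_d_spin_\<alpha>[OF assms(1)])
qed

end

theorem proposition8p4:
  fixes M :: "(complex \<times> real \<times> real) set"
    and f a Z L :: "complex \<Rightarrow> real \<Rightarrow> complex"
    and lg :: "complex \<Rightarrow> complex"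
    and g :: "real \<Rightarrow> complex"
    and k :: real
  assumes "vacuum_pp_wave M f"
    and "continuous_on (fst ` M) lg"
    and "\<And>\<zeta>. \<zeta> \<in> fst ` M \<Longrightarrow> exp (lg \<zeta>) = \<zeta>"
    and "\<And>\<zeta> u v. (\<zeta>, u, v) \<in> M \<Longrightarrow> f \<zeta> u = exp (\<i> * of_real k) * lg \<zeta> + g u * \<zeta>"
    and "pp_wave_data M f a Z L"
  shows "((\<forall>p\<in>M. \<forall>\<xi> \<eta>. wedge (ext_d (spin_\<alpha> a) p) (ext_d (spin_\<nu> f a Z) p) \<xi> \<eta> = 0)
            \<longleftrightarrow> (\<forall>p\<in>M. inv_Y f a Z L p = 0))
       \<and> ((\<forall>p\<in>M. inv_Y f a Z L p = 0) \<longleftrightarrow> (\<forall>(\<zeta>, u, v)\<in>M. g u = 0))"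
proof -
  interpret log_pp_wave M f a Z L lg g k
    by unfold_locales (use assms in blast)+
  have Y: "(\<forall>p\<in>M. inv_Y f a Z L p = 0) \<longleftrightarrow> (\<forall>(\<zeta>, u, v)\<in>M. g u = 0)"
    by (auto simp: inv_Y_eq_0_iff)
  moreover have "(\<forall>p\<in>M. \<forall>\<xi> \<eta>. wedge (ext_d (spin_\<alpha> a) p) (ext_d (spin_\<nu> f a Z) p) \<xi> \<eta> = 0)
      \<longleftrightarrow> (\<forall>(\<zeta>, u, v)\<in>M. g u = 0)" (is "?W \<longleftrightarrow> ?G")
  proof
    assume ?W
    thus ?G using wedge_eq_0_imp by fast
  next
    assume ?G
    hence "\<And>z u v. (z, u, v) \<in> M \<Longrightarrow> g u = 0" by blast
    thus ?W using wedge_eq_0 by fast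
  qed
  ultimately show ?thesis by blast
qed

end
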